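(* Let $L:\mathbb{R}^n\to\mathbb{R}$ be twice continuously differentiable, $\beta$-strongly convex for some $\beta>0$, and $K$-smooth (that is, $\nabla L$ is $K$-Lipschitz). Let $\tau_{min},\tau_{max}$ satisfy $0<\tau_{min}\le\tau_{max}<\frac{\beta^2}{3K^3}$. Let $\mathcal{H}=(C,f,D,G)$ be the hybrid system with state $\xi=(z_1,z_2,\tau)$ described in the context. Then for each solution $\phi$ to $\mathcal{H}$ and for all $(t,j)\in\operatorname{dom}\phi$ such that $j\ge 1$, $$|\phi(t,j)|_{\mathcal{A}}\le \frac{8}{3}\sqrt[4]{2}\,\sqrt{\frac{K}{\beta}}\,\exp\Big(-\frac{\beta A B}{8K^2}\,t\Big)\,|\phi(0,0)|_{\mathcal{A}},$$ where $A=\beta^2(1-2\tau_{max}K)-\tau_{max}K^3>0$ and $B=1-2\tau_{max}K\in(0,1)$.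
   Context: Hybrid system. Let $\mathcal{X}=\mathbb{R}^n\times\mathbb{R}^n\times[0,\tau_{max}]$ and $\xi=(z_1,z_2,\tau)\in\mathcal{X}$. The hybrid system $\mathcal{H}=(C,f,D,G)$ is $$\dot\xi=f(\xi):=(-\nabla L(z_2),\,0,\,-1)\ \text{ for }\xi\in C:=\mathcal{X},\qquad \xi^+\in G(\xi):=\{z_1\}\times\{z_1\}\times[\tau_{min},\tau_{max}]\ \text{ for }\xi\in D:=\mathbb{R}^n\times\mathbb{R}^n\times\{0\}.$$ Solutions. A hybrid time domain is a set $E\subset\mathbb{R}_{\ge0}\times\mathbb{N}$ such that for every $(T,J)\in E$, $E\cap([0,T]\times\{0,\dots,J\})=\bigcup_{j=0}^{J}[t_j,t_{j+1}]\times\{j\}$ for some $0=t_0\le t_1\le\dots\le t_{J+1}=T$. A solution $\phi=(\phi_{z_1},\phi_{z_2},\phi_\tau)$ to $\mathcal{H}$ is a function on a (nonempty) hybrid time domain $\operatorname{dom}\phi$ with $\phi(0,0)\in C\cup D$ such that, writing $I^j=\{t:(t,j)\in\operatorname{dom}\phi\}$: for each $j$, $t\mapsto\phi(t,j)$ is locally absolutely continuous on $I^j$; if $I^j$ has nonempty interior, then $\phi(t,j)\in C$ for all $t$ in the interior of $I^j$ and $\frac{d}{dt}\phi(t,j)=f(\phi(t,j))$ for almost all $t\in I^j$; and whenever $(t,j),(t,j+1)\in\operatorname{dom}\phi$, $\phi(t,j)\in D$ and $\phi(t,j+1)\in G(\phi(t,j))$. Target set. Let $x^*$ be the unique minimizer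 of $L$, i.e. the unique point with $\nabla L(x^* )=0$. Then $\mathcal{A}:=\{\xi=(z_1,z_2,\tau)\in\mathcal{X}:\nabla L(z_2)=0,\ z_2=z_1\}=\{x^*\}\times\{x^*\}\times[0,\tau_{max}]$, and $|\xi|_{\mathcal{A}}:=\sqrt{\|z_1-x^*\|^2+\|z_2-x^*\|^2}$, with $\|\cdot\|$ the Euclidean norm. *)

theory Defs
  imports "HOL-Analysis.Analysis"
begin

section \<open>Regularity of the objective function\<close>

definition gradient :: "('a::real_inner \<Rightarrow> real) \<Rightarrow> 'a \<Rightarrow> 'a" where
  "gradient L x = (THE g. GDERIV L x :> g)"

lemma gradient_eq:
  assumes "GDERIV L x :> g"
  shows "gradient L x = g"
  unfolding gradient_def
proof (rule the_equality)
  fix h assume "GDERIV L x :> h"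
  with assms have "(\<lambda>d. d \<bullet> h) = (\<lambda>d. d \<bullet> g)"
    unfolding gderiv_def by (blast intro: has_derivative_unique)
  then show "h = g"
    by (metis inner_commute vector_eq_rdot)
qed (rule assms)

definition twice_continuously_differentiable :: "('a::real_normed_vector \<Rightarrow> real) \<Rightarrow> bool" where
  "twice_continuously_differentiable L \<longleftrightarrow>
     (\<exists>(L1 :: 'a \<Rightarrow> 'a \<Rightarrow>\<^sub>L real) (L2 :: 'a \<Rightarrow> 'a \<Rightarrow>\<^sub>L ('a \<Rightarrow>\<^sub>L real)).
        (\<forall>x. (L has_derivative blinfun_apply (L1 x)) (at x)) \<and>
        (\<forall>x. (L1 has_derivative blinfun_apply (L2 x)) (at x)) \<and>
        continuous_on UNIV L2)"

definition strongly_convex :: "real \<Rightarrow> ('a::real_inner \<Rightarrow> real) \<Rightarrow> bool" where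
  "strongly_convex \<beta> L \<longleftrightarrow>
     (\<forall>x y. \<forall>u\<in>{0..1}.
        L ((1 - u) *\<^sub>R x + u *\<^sub>R y)
          \<le> (1 - u) * L x + u * L y - \<beta> / 2 * u * (1 - u) * (norm (x - y))\<^sup>2)"

definition smooth :: "real \<Rightarrow> ('a::real_inner \<Rightarrow> real) \<Rightarrow> bool" where
  "smooth K L \<longleftrightarrow> (\<forall>x. L differentiable at x) \<and> K-lipschitz_on UNIV (gradient L)"


section \<open>Absolute continuity\<close>

text \<open>The library constant \<open>absolutely_continuous\<close> is about measures. The intervals below may
  share endpoints, hence disjointness is required of their interiors only.\<close>

definition absolutely_continuous_fun_on :: "real set \<Rightarrow> (real \<Rightarrow> 'a::real_normed_vector) \<Rightarrow> bool" where
  "absolutely_continuous_fun_on S f \<longleftrightarrow>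
     (\<forall>\<epsilon>>0. \<exists>\<delta>>0. \<forall>(m::nat) u v.
        (\<forall>i<m. u i \<le> v i \<and> {u i..v i} \<subseteq> S) \<and>
        disjoint_family_on (\<lambda>i. {u i<..<v i}) {..<m} \<and>
        (\<Sum>i<m. v i - u i) < \<delta> \<longrightarrow>
        (\<Sum>i<m. norm (f (v i) - f (u i))) < \<epsilon>)"

definition locally_absolutely_continuous_on :: "real set \<Rightarrow> (real \<Rightarrow> 'a::real_normed_vector) \<Rightarrow> bool" where
  "locally_absolutely_continuous_on S f \<longleftrightarrow>
     (\<forall>a b. {a..b} \<subseteq> S \<longrightarrow> absolutely_continuous_fun_on {a..b} f)"


section \<open>Hybrid systems and their solutions\<close>

record 'a hybrid_system =
  flow_set :: "'a set"
  flow_map :: "'a \<Rightarrow> 'a"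
  jump_set :: "'a set"
  jump_map :: "'a \<Rightarrow> 'a set"

definition hybrid_time_domain :: "(real \<times> nat) set \<Rightarrow> bool" where
  "hybrid_time_domain E \<longleftrightarrow>
     E \<subseteq> {0..} \<times> UNIV \<and>
     (\<forall>(T, J)\<in>E. \<exists>t::nat \<Rightarrow> real.
        t 0 = 0 \<and> (\<forall>j\<le>J. t j \<le> t (Suc j)) \<and> t (Suc J) = T \<and>
        E \<inter> ({0..T} \<times> {0..J}) = (\<Union>j\<in>{0..J}. {t j..t (Suc j)} \<times> {j}))"

definition time_slice :: "(real \<times> nat) set \<Rightarrow> nat \<Rightarrow> real set" where
  "time_slice E j = {t. (t, j) \<in> E}"

text \<open>A solution is given by its domain \<open>E\<close> and a function \<open>\<phi>\<close> whose values outside \<open>E\<close> are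
  irrelevant. Solutions need not be maximal or complete.\<close>

definition hybrid_solution ::
  "'a::real_normed_vector hybrid_system \<Rightarrow> (real \<times> nat) set \<Rightarrow> (real \<Rightarrow> nat \<Rightarrow> 'a) \<Rightarrow> bool" where
  "hybrid_solution H E \<phi> \<longleftrightarrow>
     hybrid_time_domain E \<and> E \<noteq> {} \<and>
     \<phi> 0 0 \<in> flow_set H \<union> jump_set H \<and>
     (\<forall>j. locally_absolutely_continuous_on (time_slice E j) (\<lambda>t. \<phi> t j)) \<and>
     (\<forall>j. interior (time_slice E j) \<noteq> {} \<longrightarrow>
        (\<forall>t\<in>interior (time_slice E j). \<phi> t j \<in> flow_set H) \<and>
        (AE t in lebesgue. t \<in> time_slice E j \<longrightarrow>
           ((\<lambda>s. \<phi> s j) has_vector_derivative flow_map H (\<phi> t j)) (at t within time_slice E j))) \<and>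
     (\<forall>t j. (t, j) \<in> E \<and> (t, Suc j) \<in> E \<longrightarrow>
        \<phi> t j \<in> jump_set H \<and> \<phi> t (Suc j) \<in> jump_map H (\<phi> t j))"


section \<open>The hybrid gradient system\<close>

definition state_space :: "real \<Rightarrow> ('a \<times> 'a \<times> real) set" where
  "state_space \<tau>max = UNIV \<times> UNIV \<times> {0..\<tau>max}"

definition gradient_hybrid_system ::
  "('a::real_inner \<Rightarrow> real) \<Rightarrow> real \<Rightarrow> real \<Rightarrow> ('a \<times> 'a \<times> real) hybrid_system" where
  "gradient_hybrid_system L \<tau>min \<tau>max =
     \<lparr>flow_set = state_space \<tau>max,
      flow_map = (\<lambda>(z1, z2, \<tau>). (- gradient L z2, 0, - 1)),
      jump_set = UNIV \<times> UNIV \<times> {0},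
      jump_map = (\<lambda>(z1, z2, \<tau>). {z1} \<times> {z1} \<times> {\<tau>min..\<tau>max})\<rparr>"

definition minimizer :: "('a \<Rightarrow> real) \<Rightarrow> 'a" where
  "minimizer L = (THE x. \<forall>y. L x \<le> L y)"

definition target_set :: "('a::real_inner \<Rightarrow> real) \<Rightarrow> real \<Rightarrow> ('a \<times> 'a \<times> real) set" where
  "target_set L \<tau>max = {(z1, z2, \<tau>) \<in> state_space \<tau>max. gradient L z2 = 0 \<and> z2 = z1}"

definition target_dist :: "('a::real_inner \<Rightarrow> real) \<Rightarrow> 'a \<times> 'a \<times> real \<Rightarrow> real" where
  "target_dist L = (\<lambda>(z1, z2, \<tau>).
     sqrt ((norm (z1 - minimizer L))\<^sup>2 + (norm (z2 - minimizer L))\<^sup>2))"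

text \<open>On the state space, \<open>target_dist\<close> is the Euclidean distance to \<open>target_set\<close>, provided that
  the minimizer is the only critical point.\<close>

lemma target_dist_eq_infdist:
  fixes L :: "'a::real_inner \<Rightarrow> real"
  assumes crit: "\<And>x. gradient L x = 0 \<longleftrightarrow> x = minimizer L"
    and \<xi>: "\<xi> \<in> state_space \<tau>max"
  shows "target_dist L \<xi> = infdist \<xi> (target_set L \<tau>max)"
proof -
  obtain z1 z2 \<tau> where eq: "\<xi> = (z1, z2, \<tau>)" and \<tau>: "\<tau> \<in> {0..\<tau>max}"
    using \<xi> by (cases \<xi>) (auto simp: state_space_def)
  define x where "x = minimizer L"
  have A: "target_set L \<tau>max = {x} \<times> {x} \<times> {0..\<tau>max}"
    using crit by (auto simp: target_set_def state_space_def x_def)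
  have mem: "(x, x, \<tau>) \<in> target_set L \<tau>max"
    using \<tau> by (simp add: A)
  have dist: "dist \<xi> (x, x, s) = sqrt ((norm (z1 - x))\<^sup>2 + ((norm (z2 - x))\<^sup>2 + (dist \<tau> s)\<^sup>2))" for s
    by (simp add: eq dist_norm norm_Pair)
  have tdist: "target_dist L \<xi> = dist \<xi> (x, x, \<tau>)"
    unfolding dist by (simp add: target_dist_def eq x_def)
  show ?thesis
  proof (rule antisym)
    show "target_dist L \<xi> \<le> infdist \<xi> (target_set L \<tau>max)"
    proof -
      have ne: "target_set L \<tau>max \<noteq> {}"
        using mem by blast
      have "target_dist L \<xi> \<le> dist \<xi> a" if "a \<in> target_set L \<tau>max" for a
      proof -
        from that obtain s where "a = (x, x, s)"
          by (auto simp: A)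
        then show ?thesis
          unfolding tdist dist by (simp add: dist)
      qed
      then show ?thesis
        unfolding infdist_notempty[OF ne] by (rule cINF_greatest[OF ne])
    qed
    show "infdist \<xi> (target_set L \<tau>max) \<le> target_dist L \<xi>"
      unfolding tdist by (rule infdist_le[OF mem])
  qed
qed

end

theory Submission
  imports Defs
begin

text \<open>While the system flows, \<open>z2\<close> is frozen and \<open>z1\<close> moves with constant velocity, because an
  absolutely continuous function is the integral of its almost everywhere derivative. From the first
  jump on, which happens by time \<open>\<tau>max\<close>, the system therefore performs gradient descent
  with step sizes equal to the dwell times, which are at most \<open>\<tau>max\<close>. Since
  \<open>\<tau>max * K\<^sup>2 \<le> \<beta> / 3\<close>, a step of size \<open>s\<close> shrinks the distance to the minimizer by a
  factor of at most \<open>exp (- \<beta> * s / 8)\<close>, and the stated rate is at most \<open>\<beta> / 8\<close>. The component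
  \<open>z2\<close> lags behind by one dwell time; this lag and the first phase cost a bounded factor.\<close>

section \<open>Absolutely continuous functions\<close>

text \<open>The definition numbers the intervals by naturals, whereas the cells of a tagged division
  are indexed by pairs of a tag and a cell. Enumerating \<open>I\<close> by a bijection bridges the
  two.\<close>

lemma absolutely_continuous_fun_onE_finite:
  fixes f :: "real \<Rightarrow> 'a::real_normed_vector"
  assumes "absolutely_continuous_fun_on S f" and "\<epsilon> > 0"
  obtains \<delta> where "\<delta> > 0"
    and "\<And>(I :: 'i set) u v. \<lbrakk>finite I; \<And>i. i \<in> I \<Longrightarrow> u i \<le> v i; \<And>i. i \<in> I \<Longrightarrow> {u i..v i} \<subseteq> S;
      disjoint_family_on (\<lambda>i. {u i<..<v i}) I; (\<Sum>i\<in>I. v i - u i) < \<delta>\<rbrakk>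
      \<Longrightarrow> (\<Sum>i\<in>I. norm (f (v i) - f (u i))) < \<epsilon>"
proof -
  obtain \<delta> where "\<delta> > 0"
    and \<delta>: "\<forall>(m::nat) u v. (\<forall>i<m. u i \<le> v i \<and> {u i..v i} \<subseteq> S) \<and>
        disjoint_family_on (\<lambda>i. {u i<..<v i}) {..<m} \<and> (\<Sum>i<m. v i - u i) < \<delta> \<longrightarrow>
        (\<Sum>i<m. norm (f (v i) - f (u i))) < \<epsilon>"
    using assms unfolding absolutely_continuous_fun_on_def by blast
  have "(\<Sum>i\<in>I. norm (f (v i) - f (u i))) < \<epsilon>"
    if "finite I" and le: "\<And>i. i \<in> I \<Longrightarrow> u i \<le> v i" and sub: "\<And>i. i \<in> I \<Longrightarrow> {u i..v i} \<subseteq> S"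
      and disj: "disjoint_family_on (\<lambda>i. {u i<..<v i}) I" and sum: "(\<Sum>i\<in>I. v i - u i) < \<delta>"
    for I :: "'i set" and u v
  proof -
    obtain h where h: "bij_betw h {..<card I} I"
      using ex_bij_betw_nat_finite[OF \<open>finite I\<close>] by (auto simp: atLeast0LessThan)
    then have hI: "h i \<in> I" if "i < card I" for i
      using that bij_betwE by blast
    have "(\<Sum>i<card I. norm (f (v (h i)) - f (u (h i)))) < \<epsilon>"
    proof (rule \<delta>[rule_format], intro conjI)
      show "\<forall>i<card I. u (h i) \<le> v (h i) \<and> {u (h i)..v (h i)} \<subseteq> S"
        using le sub hI by blast
      show "disjoint_family_on (\<lambda>i. {u (h i)<..<v (h i)}) {..<card I}"
        unfolding disjoint_family_on_def
      proof (intro ballI impI)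
        fix i j assume ij: "i \<in> {..<card I}" "j \<in> {..<card I}" "i \<noteq> j"
        then have "h i \<noteq> h j"
          using h by (auto simp: bij_betw_def inj_on_def)
        then show "{u (h i)<..<v (h i)} \<inter> {u (h j)<..<v (h j)} = {}"
          using disj hI ij unfolding disjoint_family_on_def by (meson lessThan_iff)
      qed
      show "(\<Sum>i<card I. v (h i) - u (h i)) < \<delta>"
        using sum sum.reindex_bij_betw[OF h, of "\<lambda>i. v i - u i"] by simp
    qed
    then show ?thesis
      using sum.reindex_bij_betw[OF h, of "\<lambda>i. norm (f (v i) - f (u i))"] by simp
  qed
  then show ?thesis
    using that \<open>\<delta> > 0\<close> by blast
qed

text \<open>Each length is the measure of the open interval, so finite additivity and monotonicity
  apply.\<close>

lemma sum_lengths_le_measure: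
  fixes u v :: "'i \<Rightarrow> real"
  assumes "finite I" and "\<And>i. i \<in> I \<Longrightarrow> u i \<le> v i"
    and "disjoint_family_on (\<lambda>i. {u i<..<v i}) I"
    and "\<And>i. i \<in> I \<Longrightarrow> {u i<..<v i} \<subseteq> U" and "U \<in> lmeasurable"
  shows "(\<Sum>i\<in>I. v i - u i) \<le> measure lebesgue U"
proof -
  have "(\<Sum>i\<in>I. v i - u i) = (\<Sum>i\<in>I. measure lebesgue {u i<..<v i})"
    using assms(2) by (intro sum.cong) auto
  also have "\<dots> = measure lebesgue (\<Union>i\<in>I. {u i<..<v i})"
    by (rule measure_finite_Union[symmetric]) (use assms in auto)
  also have "\<dots> \<le> measure lebesgue U"
    by (rule measure_mono_fmeasurable) (use assms in auto)
  finally show ?thesis .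
qed

text \<open>A gauge that keeps the intervals tagged in the exceptional null set inside an open set of
  small measure leaves their contribution to absolute continuity.\<close>

theorem fundamental_theorem_of_calculus_absolutely_continuous:
  fixes f :: "real \<Rightarrow> 'a::banach"
  assumes "a \<le> b" and ac: "absolutely_continuous_fun_on {a..b} f"
    and "AE t in lebesgue. t \<in> {a..b} \<longrightarrow> (f has_vector_derivative f' t) (at t within {a..b})"
  shows "(f' has_integral f b - f a) {a..b}"
proof -
  obtain N where N: "N \<in> null_sets lebesgue"
    and der: "\<And>t. t \<in> {a..b} \<Longrightarrow> t \<notin> N \<Longrightarrow> (f has_vector_derivative f' t) (at t within {a..b})"
    using assms(3) by (rule AE_E3) auto
  \<comment> \<open>The value 0 on \<open>N\<close> removes tags in \<open>N\<close> from the
    Riemann sum, whatever \<open>f'\<close> is there. The final spike argument returns from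
    \<open>g\<close> to \<open>f'\<close>.\<close>
  define g where "g t = (if t \<in> N then 0 else f' t)" for t
  have "(g has_integral f b - f a) {a..b}"
    unfolding has_integral_real
  proof (intro allI impI)
    fix e :: real assume "e > 0"
    \<comment> \<open>Tags outside \<open>N\<close> will cost at most
      \<open>\<eta> * (b - a)\<close>, half of \<open>e\<close>; the summand 1 avoids a division by
      zero when \<open>a = b\<close>.\<close>
    define \<eta> where "\<eta> = e / (2 * (b - a + 1))"
    have "\<eta> > 0" and \<eta>: "\<eta> * (b - a) \<le> e / 2"
      using \<open>e > 0\<close> \<open>a \<le> b\<close> by (auto simp: \<eta>_def field_simps)
    \<comment> \<open>At a point of differentiability \<open>x\<close> the linear approximation is
      accurate within distance \<open>d x\<close>; elsewhere the claim is vacuous and the radius 1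
      is taken.\<close>
    have "\<exists>d>0. x \<in> {a..b} \<longrightarrow> x \<notin> N \<longrightarrow>
        (\<forall>y\<in>{a..b}. norm (y - x) < d \<longrightarrow> norm (f y - f x - (y - x) *\<^sub>R f' x) \<le> \<eta> * norm (y - x))" for x
      using der[of x] \<open>\<eta> > 0\<close> unfolding has_vector_derivative_def has_derivative_within_alt
      by (cases "x \<in> {a..b} \<and> x \<notin> N") (auto intro: exI[of _ 1])
    then obtain d where d': "\<And>x. 0 < d x \<and> (x \<in> {a..b} \<longrightarrow> x \<notin> N \<longrightarrow>
        (\<forall>y\<in>{a..b}. norm (y - x) < d x \<longrightarrow> norm (f y - f x - (y - x) *\<^sub>R f' x) \<le> \<eta> * norm (y - x)))"
      by metis
    then have d: "\<And>x. 0 < d x"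
      "\<And>x y. \<lbrakk>x \<in> {a..b}; x \<notin> N; y \<in> {a..b}; norm (y - x) < d x\<rbrakk>
        \<Longrightarrow> norm (f y - f x - (y - x) *\<^sub>R f' x) \<le> \<eta> * norm (y - x)"
      by simp_all
    obtain \<delta> where "\<delta> > 0"
      and \<delta>: "\<And>(I :: (real \<times> real set) set) u v. \<lbrakk>finite I; \<And>i. i \<in> I \<Longrightarrow> u i \<le> v i;
        \<And>i. i \<in> I \<Longrightarrow> {u i..v i} \<subseteq> {a..b}; disjoint_family_on (\<lambda>i. {u i<..<v i}) I;
        (\<Sum>i\<in>I. v i - u i) < \<delta>\<rbrakk> \<Longrightarrow> (\<Sum>i\<in>I. norm (f (v i) - f (u i))) < e / 2"
      using \<open>e > 0\<close>
      by (rule absolutely_continuous_fun_onE_finite[OF ac half_gt_zero, where 'i = "real \<times> real set"]) blast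
    obtain U where U: "open U" "N \<subseteq> U" "U - N \<in> lmeasurable" "emeasure lebesgue (U - N) < ennreal \<delta>"
      using sets_lebesgue_outer_open[of N \<delta>] N \<open>\<delta> > 0\<close> by auto
    have Um: "U \<in> lmeasurable"
      using U N by (metis borel_open measurable_Diff_null_set sets_completionI_sets sets_lborel)
    \<comment> \<open>The outer approximation bounds only \<open>U - N\<close>; as \<open>N\<close>
      is null, \<open>U\<close> has the same measure.\<close>
    have U\<delta>: "measure lebesgue U < \<delta>"
    proof -
      have "measure lebesgue U = measure lebesgue (U - N)"
        using Um N by (simp add: fmeasurableD measure_Diff_null_set)
      also have "\<dots> < \<delta>"
        using U(3,4) \<open>\<delta> > 0\<close> by (simp add: emeasure_eq_measure2 ennreal_less_iff)
      finally show ?thesis .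
    qed
    define \<gamma> where "\<gamma> x = (if x \<in> N then U else ball x (d x))" for x
    have "gauge \<gamma>"
      using U d(1) by (auto simp: gauge_def \<gamma>_def)
    moreover have "norm ((\<Sum>(x, k)\<in>p. measure lborel k *\<^sub>R g x) - (f b - f a)) < e"
      if p: "p tagged_division_of {a..b}" and fine: "\<gamma> fine p" for p
    proof -
      have "finite p"
        using p by blast
      \<comment> \<open>Cells are compact intervals, so \<open>Inf k\<close> and
        \<open>Sup k\<close> serve as endpoints that are explicit functions of the cell.\<close>
      have k: "Inf k \<le> Sup k" "k = {Inf k..Sup k}" "{Inf k..Sup k} \<subseteq> {a..b}"
        "x \<in> {Inf k..Sup k}" "measure lborel k = Sup k - Inf k" "k \<subseteq> \<gamma> x" if "(x, k) \<in> p" for x k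
      proof -
        have "x \<in> k" "k \<subseteq> {a..b}"
          using that p by blast+
        moreover from tagged_division_ofD(4)[OF p that] obtain u v where "k = cbox u v"
          by blast
        moreover have "k \<subseteq> \<gamma> x"
          using that fine by blast
        ultimately show "Inf k \<le> Sup k" "k = {Inf k..Sup k}" "{Inf k..Sup k} \<subseteq> {a..b}"
          "x \<in> {Inf k..Sup k}" "measure lborel k = Sup k - Inf k" "k \<subseteq> \<gamma> x"
          by (simp_all add: cbox_interval)
      qed
      have disj: "disjoint_family_on (\<lambda>i. {Inf (snd i)<..<Sup (snd i)}) p"
        unfolding disjoint_family_on_def
      proof (intro ballI impI)
        fix i j assume "i \<in> p" "j \<in> p" "i \<noteq> j"
        then have "interior (snd i) \<inter> interior (snd j) = {}"
          using tagged_division_ofD(5)[OF p, of "fst i" "snd i" "fst j" "snd j"] by simp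
        moreover have "interior (snd i) = {Inf (snd i)<..<Sup (snd i)}" if "i \<in> p" for i
          using k(2)[of "fst i" "snd i"] that by (metis interior_atLeastAtMost_real prod.collapse)
        ultimately show "{Inf (snd i)<..<Sup (snd i)} \<inter> {Inf (snd j)<..<Sup (snd j)} = {}"
          using \<open>i \<in> p\<close> \<open>j \<in> p\<close> by metis
      qed
      define q where "q = {i \<in> p. fst i \<in> N}"
      have q: "finite q" "q \<subseteq> p"
        using \<open>finite p\<close> by (auto simp: q_def)
      have disjq: "disjoint_family_on (\<lambda>i. {Inf (snd i)<..<Sup (snd i)}) q"
        using disj q(2) by (rule disjoint_family_on_mono[rotated])
      \<comment> \<open>Fineness puts every cell tagged in \<open>N\<close> inside \<open>U\<close>,
        so these cells have total length below \<open>\<delta>\<close> and absolute continuity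
        applies.\<close>
      have bad: "(\<Sum>i\<in>q. norm (f (Sup (snd i)) - f (Inf (snd i)))) < e / 2"
      proof (rule \<delta>[OF \<open>finite q\<close> _ _ disjq])
        show "Inf (snd i) \<le> Sup (snd i)" "{Inf (snd i)..Sup (snd i)} \<subseteq> {a..b}" if "i \<in> q" for i
          using k(1,3)[of "fst i" "snd i"] that q by auto
        have "(\<Sum>i\<in>q. Sup (snd i) - Inf (snd i)) \<le> measure lebesgue U"
        proof (rule sum_lengths_le_measure[OF \<open>finite q\<close> _ disjq _ Um])
          show "Inf (snd i) \<le> Sup (snd i)" if "i \<in> q" for i
            using k(1)[of "fst i" "snd i"] that q by auto
          show "{Inf (snd i)<..<Sup (snd i)} \<subseteq> U" if "i \<in> q" for i
          proof -
            have "snd i \<subseteq> U" "snd i = {Inf (snd i)..Sup (snd i)}"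
              using k(2,6)[of "fst i" "snd i"] that by (auto simp: q_def \<gamma>_def)
            then show ?thesis
              by (metis greaterThanLessThan_subseteq_atLeastAtMost_iff order_refl subset_trans)
          qed
        qed
        then show "(\<Sum>i\<in>q. Sup (snd i) - Inf (snd i)) < \<delta>"
          using U\<delta> by simp
      qed
      \<comment> \<open>Both differences telescope over the division, so the error of the Riemann
        sum can be estimated cell by cell.\<close>
      have ba: "b - a = (\<Sum>(x, k)\<in>p. Sup k - Inf k)" "f b - f a = (\<Sum>(x, k)\<in>p. f (Sup k) - f (Inf k))"
        using additive_tagged_division_1[where f = "\<lambda>x. x"] additive_tagged_division_1[where f = f]
          \<open>a \<le> b\<close> p by auto
      have "norm ((\<Sum>(x, k)\<in>p. measure lborel k *\<^sub>R g x) - (f b - f a))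
          = norm (\<Sum>i\<in>p. measure lborel (snd i) *\<^sub>R g (fst i) - (f (Sup (snd i)) - f (Inf (snd i))))"
        unfolding ba by (simp add: sum_subtractf split_def)
      also have "\<dots> \<le> (\<Sum>i\<in>p. \<eta> * (Sup (snd i) - Inf (snd i))
          + (if fst i \<in> N then norm (f (Sup (snd i)) - f (Inf (snd i))) else 0))"
      proof (rule sum_norm_le)
        fix i assume "i \<in> p"
        obtain x k where i: "i = (x, k)"
          by fastforce
        define u v where "u = Inf k" and "v = Sup k"
        have xk: "u \<le> v" "k = {u..v}" "{u..v} \<subseteq> {a..b}" "x \<in> {u..v}" "measure lborel k = v - u" "k \<subseteq> \<gamma> x"
          using k[of x k] \<open>i \<in> p\<close> by (auto simp: i u_def v_def)
        have "norm (measure lborel k *\<^sub>R g x - (f v - f u))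
            \<le> \<eta> * (v - u) + (if x \<in> N then norm (f v - f u) else 0)"
        proof (cases "x \<in> N")
          case True
          then show ?thesis
            using \<open>\<eta> > 0\<close> xk(1) by (simp add: g_def norm_minus_commute)
        next
          case False
          have uv: "norm (u - x) < d x" "norm (v - x) < d x"
            using xk(1,2,6) False by (auto simp: \<gamma>_def subset_iff dist_real_def abs_minus_commute)
          have mem: "x \<in> {a..b}" "u \<in> {a..b}" "v \<in> {a..b}"
            using xk by auto
          \<comment> \<open>Both endpoints are compared with the tag; since \<open>x\<close> lies
            between \<open>u\<close> and \<open>v\<close>, the two distances add up to
            \<open>v - u\<close>.\<close>
          have "norm ((v - u) *\<^sub>R f' x - (f v - f u))
              = norm (f u - f x - (u - x) *\<^sub>R f' x - (f v - f x - (v - x) *\<^sub>R f' x))"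
            by (auto simp: algebra_simps)
          also have "\<dots> \<le> norm (f u - f x - (u - x) *\<^sub>R f' x) + norm (f v - f x - (v - x) *\<^sub>R f' x)"
            by (rule norm_triangle_ineq4)
          also have "\<dots> \<le> \<eta> * norm (u - x) + \<eta> * norm (v - x)"
            using d(2) False mem uv by (intro add_mono) auto
          also have "\<dots> = \<eta> * (v - u)"
            using xk(4) by (auto simp: algebra_simps)
          finally show ?thesis
            using False xk(5) by (simp add: g_def)
        qed
        then show "norm (measure lborel (snd i) *\<^sub>R g (fst i) - (f (Sup (snd i)) - f (Inf (snd i))))
            \<le> \<eta> * (Sup (snd i) - Inf (snd i))
              + (if fst i \<in> N then norm (f (Sup (snd i)) - f (Inf (snd i))) else 0)"
          unfolding i fst_conv snd_conv u_def v_def .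
      qed
      also have "\<dots> = \<eta> * (b - a) + (\<Sum>i\<in>q. norm (f (Sup (snd i)) - f (Inf (snd i))))"
        unfolding ba(1) q_def
        by (simp add: sum.distrib sum_distrib_left split_def sum.inter_filter[OF \<open>finite p\<close>])
      also have "\<dots> < e"
        using \<eta> bad by simp
      finally show ?thesis .
    qed
    ultimately show "\<exists>\<gamma>. gauge \<gamma> \<and> (\<forall>p. p tagged_division_of {a..b} \<and> \<gamma> fine p \<longrightarrow>
        norm ((\<Sum>(x, k)\<in>p. measure lborel k *\<^sub>R g x) - (f b - f a)) < e)"
      by (intro exI[of _ \<gamma>]) simp
  qed
  then show ?thesis
    by (rule has_integral_spike[rotated 2, where S = N])
      (use N in \<open>auto simp: g_def negligible_iff_null_sets\<close>)
qed

corollary absolutely_continuous_affine: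
  fixes f :: "real \<Rightarrow> 'a::banach"
  assumes "a \<le> b" and "absolutely_continuous_fun_on {a..b} f"
    and "AE t in lebesgue. t \<in> {a..b} \<longrightarrow> (f has_vector_derivative c) (at t within {a..b})"
  shows "f b = f a + (b - a) *\<^sub>R c"
proof -
  have "((\<lambda>_. c) has_integral f b - f a) {a..b}"
    by (rule fundamental_theorem_of_calculus_absolutely_continuous) (use assms in auto)
  moreover have "((\<lambda>_. c) has_integral (b - a) *\<^sub>R c) {a..b}"
    using has_integral_const_real[of c a b] \<open>a \<le> b\<close> by simp
  ultimately have "f b - f a = (b - a) *\<^sub>R c"
    by (rule has_integral_unique)
  then show ?thesis
    by (simp add: algebra_simps)
qed

text \<open>This gives access to the components of the state. A bound \<open>B\<close> for
  \<open>h\<close> reduces \<open>\<epsilon>\<close> for the image to \<open>\<epsilon> / B\<close>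
  for \<open>f\<close>.\<close>

lemma absolutely_continuous_fun_on_bounded_linear:
  assumes "absolutely_continuous_fun_on S f" and "bounded_linear h"
  shows "absolutely_continuous_fun_on S (\<lambda>t. h (f t))"
  unfolding absolutely_continuous_fun_on_def
proof (intro allI impI)
  fix \<epsilon> :: real assume "\<epsilon> > 0"
  obtain B where "B > 0" and B: "\<And>x. norm (h x) \<le> norm x * B"
    using bounded_linear.pos_bounded[OF assms(2)] by auto
  have "\<epsilon> / B > 0"
    using \<open>\<epsilon> > 0\<close> \<open>B > 0\<close> by simp
  then obtain \<delta> where "\<delta> > 0"
    and \<delta>: "\<forall>(m::nat) u v. (\<forall>i<m. u i \<le> v i \<and> {u i..v i} \<subseteq> S) \<and>
        disjoint_family_on (\<lambda>i. {u i<..<v i}) {..<m} \<and> (\<Sum>i<m. v i - u i) < \<delta> \<longrightarrow>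
        (\<Sum>i<m. norm (f (v i) - f (u i))) < \<epsilon> / B"
    using assms(1) unfolding absolutely_continuous_fun_on_def by blast
  have "(\<Sum>i<m. norm (h (f (v i)) - h (f (u i)))) < \<epsilon>"
    if "(\<forall>i<m. u i \<le> v i \<and> {u i..v i} \<subseteq> S) \<and>
        disjoint_family_on (\<lambda>i. {u i<..<v i}) {..<m} \<and> (\<Sum>i<m. v i - u i) < \<delta>"
    for m :: nat and u v
  proof -
    have "(\<Sum>i<m. norm (h (f (v i)) - h (f (u i)))) \<le> (\<Sum>i<m. norm (f (v i) - f (u i)) * B)"
      by (intro sum_mono) (metis B bounded_linear.linear[OF assms(2)] linear_diff)
    also have "\<dots> < \<epsilon>"
      using \<delta> that \<open>B > 0\<close> by (simp add: sum_distrib_right[symmetric] pos_less_divide_eq)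
    finally show ?thesis .
  qed
  with \<open>\<delta> > 0\<close> show "\<exists>\<delta>>0. \<forall>(m::nat) u v. (\<forall>i<m. u i \<le> v i \<and> {u i..v i} \<subseteq> S) \<and>
      disjoint_family_on (\<lambda>i. {u i<..<v i}) {..<m} \<and> (\<Sum>i<m. v i - u i) < \<delta> \<longrightarrow>
      (\<Sum>i<m. norm (h (f (v i)) - h (f (u i)))) < \<epsilon>"
    by blast
qed

section \<open>Gradient steps for smooth strongly convex functions\<close>

text \<open>\<open>gradient\<close> is a definite description, so a representing vector has to be
  exhibited: it is the adjoint of the derivative applied to 1.\<close>

lemma differentiable_imp_GDERIV_gradient:
  fixes L :: "'a::euclidean_space \<Rightarrow> real"
  assumes "L differentiable at x"
  shows "GDERIV L x :> gradient L x"
proof -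
  obtain L' where L': "(L has_derivative L') (at x)"
    using assms unfolding differentiable_def by blast
  have "L' = (\<lambda>d. d \<bullet> adjoint L' 1)"
    using adjoint_works[OF has_derivative_linear[OF L'], of _ 1] by (simp add: fun_eq_iff)
  then have "GDERIV L x :> adjoint L' 1"
    using L' by (simp add: gderiv_def)
  then show ?thesis
    using gradient_eq by metis
qed

text \<open>Strong convexity on the segment from \<open>x\<close> to \<open>y\<close> bounds the
  difference quotient of \<open>p\<close> at 0; letting \<open>u\<close> tend to 0 from the right
  turns the quotient into the directional derivative.\<close>

lemma strongly_convex_first_order:
  fixes L :: "'a::euclidean_space \<Rightarrow> real"
  assumes "strongly_convex \<beta> L" and "L differentiable at x"
  shows "L x + gradient L x \<bullet> (y - x) + \<beta> / 2 * (norm (y - x))\<^sup>2 \<le> L y"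
proof -
  define p where "p u = L (x + u *\<^sub>R (y - x))" for u
  have "((\<lambda>u. x + u *\<^sub>R (y - x)) has_derivative (\<lambda>u. u *\<^sub>R (y - x))) (at 0)"
    by (auto intro!: derivative_eq_intros)
  moreover have "(L has_derivative (\<lambda>d. d \<bullet> gradient L x)) (at (x + 0 *\<^sub>R (y - x)))"
    using differentiable_imp_GDERIV_gradient[OF assms(2)] by (simp add: gderiv_def)
  ultimately have "(p has_derivative (\<lambda>u. (u *\<^sub>R (y - x)) \<bullet> gradient L x)) (at 0)"
    unfolding p_def by (rule has_derivative_compose)
  then have "(p has_real_derivative gradient L x \<bullet> (y - x)) (at 0)"
    by (simp add: has_field_derivative_def inner_commute mult_commute_abs)
  then have "((\<lambda>u. (p u - p 0) / u) \<longlongrightarrow> gradient L x \<bullet> (y - x)) (at_right 0)"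
    unfolding has_field_derivative_iff by (auto intro: tendsto_mono[OF at_le])
  moreover have "((\<lambda>u. L y - L x - \<beta> / 2 * (1 - u) * (norm (y - x))\<^sup>2)
      \<longlongrightarrow> L y - L x - \<beta> / 2 * (1 - 0) * (norm (y - x))\<^sup>2) (at_right 0)"
    by (intro tendsto_intros)
  moreover have "\<forall>\<^sub>F u in at_right 0. (p u - p 0) / u \<le> L y - L x - \<beta> / 2 * (1 - u) * (norm (y - x))\<^sup>2"
    using eventually_at_right_less[of 0] eventually_at_right_real[OF zero_less_one]
  proof eventually_elim
    case (elim u)
    have "p u = L ((1 - u) *\<^sub>R x + u *\<^sub>R y)"
      by (simp add: p_def algebra_simps)
    also have "\<dots> \<le> (1 - u) * L x + u * L y - \<beta> / 2 * u * (1 - u) * (norm (x - y))\<^sup>2"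
      using assms(1) elim unfolding strongly_convex_def by simp
    finally have "p u - p 0 \<le> (L y - L x - \<beta> / 2 * (1 - u) * (norm (y - x))\<^sup>2) * u"
      by (simp add: p_def norm_minus_commute algebra_simps)
    then show ?case
      using elim by (simp add: pos_divide_le_eq)
  qed
  ultimately have "gradient L x \<bullet> (y - x) \<le> L y - L x - \<beta> / 2 * (1 - 0) * (norm (y - x))\<^sup>2"
    by (intro tendsto_le[of "at_right 0"]) auto
  then show ?thesis
    by simp
qed

locale smooth_strongly_convex =
  fixes L :: "'a::euclidean_space \<Rightarrow> real" and \<beta> K :: real
  assumes strongly_convex: "strongly_convex \<beta> L" and smooth: "smooth K L" and \<beta>_pos: "\<beta> > 0"
begin

abbreviation g :: "'a \<Rightarrow> 'a" where "g \<equiv> gradient L"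

abbreviation x0 :: 'a where "x0 \<equiv> minimizer L"

lemma differentiable: "L differentiable at x"
  using smooth unfolding smooth_def by blast

lemma gradient_lipschitz: "norm (g x - g y) \<le> K * norm (x - y)"
  using smooth unfolding smooth_def by (metis UNIV_I dist_norm lipschitz_onD)

text \<open>Adding the first-order inequalities for \<open>(x, y)\<close> and \<open>(y, x)\<close>
  cancels the function values.\<close>

lemma gradient_strongly_monotone: "\<beta> * (norm (x - y))\<^sup>2 \<le> (g x - g y) \<bullet> (x - y)"
  using strongly_convex_first_order[OF strongly_convex differentiable, of x y]
    strongly_convex_first_order[OF strongly_convex differentiable, of y x]
  by (simp add: inner_diff_left inner_diff_right norm_minus_commute algebra_simps)

text \<open>Strong monotonicity and the Lipschitz bound are compared on a unit vector. The
  positivity of \<open>K\<close> follows from this.\<close>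

lemma strong_convexity_le_smoothness: "\<beta> \<le> K"
proof -
  obtain b :: 'a where b: "norm b = 1"
    using vector_choose_size[of 1] by auto
  have "\<beta> \<le> (g b - g 0) \<bullet> (b - 0)"
    using gradient_strongly_monotone[of b 0] b by simp
  also have "\<dots> \<le> norm (g b - g 0) * norm (b - 0)"
    by (rule norm_cauchy_schwarz)
  also have "\<dots> \<le> K"
    using gradient_lipschitz[of b 0] b by simp
  finally show ?thesis .
qed

lemma smoothness_pos: "K > 0"
  using strong_convexity_le_smoothness \<beta>_pos by linarith

text \<open>In the expanded square, strong monotonicity controls the cross term and the Lipschitz
  bound the quadratic one.\<close>

lemma gradient_step_contraction:
  assumes "s \<ge> 0"
  shows "(norm ((x - s *\<^sub>R g x) - (y - s *\<^sub>R g y)))\<^sup>2 \<le> (1 - 2 * s * \<beta> + s\<^sup>2 * K\<^sup>2) * (norm (x - y))\<^sup>2"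
proof -
  have "(norm ((x - s *\<^sub>R g x) - (y - s *\<^sub>R g y)))\<^sup>2
      = (norm (x - y))\<^sup>2 - 2 * s * ((g x - g y) \<bullet> (x - y)) + s\<^sup>2 * (norm (g x - g y))\<^sup>2"
    unfolding power2_norm_eq_inner
    by (simp add: inner_diff_left inner_diff_right inner_commute power2_eq_square algebra_simps)
  also have "\<dots> \<le> (norm (x - y))\<^sup>2 - 2 * s * (\<beta> * (norm (x - y))\<^sup>2) + s\<^sup>2 * (K * norm (x - y))\<^sup>2"
    using assms gradient_strongly_monotone gradient_lipschitz
    by (intro add_mono diff_mono mult_left_mono power_mono) auto
  finally show ?thesis
    by (simp add: algebra_simps power_mult_distrib)
qed

text \<open>Zeros of the gradient are the fixed points of a gradient step, so Banach's theorem
  applies once the step is a contraction.\<close>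

lemma gradient_zero_exists: "\<exists>x. g x = 0"
proof -
  \<comment> \<open>This step size minimizes
    \<open>1 - 2 * s * \<beta> + s\<^sup>2 * K\<^sup>2\<close>; the minimum is
    \<open>q\<^sup>2\<close>.\<close>
  define s where "s = \<beta> / K\<^sup>2"
  define q where "q = sqrt (1 - (\<beta> / K)\<^sup>2)"
  have "s > 0"
    using \<beta>_pos smoothness_pos by (simp add: s_def)
  have ratio: "0 < \<beta> / K" "\<beta> / K \<le> 1"
    using \<beta>_pos smoothness_pos strong_convexity_le_smoothness by auto
  then have sq: "0 < (\<beta> / K)\<^sup>2" "(\<beta> / K)\<^sup>2 \<le> 1"
    by (auto simp: power_le_one_iff)
  have q: "0 \<le> q" "q < 1" "q\<^sup>2 = 1 - (\<beta> / K)\<^sup>2"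
    using sq by (auto simp: q_def)
  have "1 - 2 * s * \<beta> + s\<^sup>2 * K\<^sup>2 = q\<^sup>2"
    using smoothness_pos unfolding q(3) by (simp add: s_def field_simps power2_eq_square)
  then have "(norm ((x - s *\<^sub>R g x) - (y - s *\<^sub>R g y)))\<^sup>2 \<le> (q * norm (x - y))\<^sup>2" for x y
    using gradient_step_contraction[of s x y] \<open>s > 0\<close> by (simp add: power_mult_distrib)
  then have "dist (x - s *\<^sub>R g x) (y - s *\<^sub>R g y) \<le> q * dist x y" for x y
    unfolding dist_norm using q(1) by (meson mult_nonneg_nonneg norm_ge_zero power2_le_imp_le)
  then have "\<exists>!x. x - s *\<^sub>R g x = x"
    using q by (intro banach_fix_type) auto
  then show ?thesis
    using \<open>s > 0\<close> by auto
qed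

text \<open>Quadratic growth around a zero of the gradient makes it the only global minimizer, hence
  the point that \<open>minimizer\<close> describes.\<close>

lemma gradient_minimizer: "g x0 = 0"
proof -
  obtain x where x: "g x = 0"
    using gradient_zero_exists by blast
  have growth: "L x + \<beta> / 2 * (norm (y - x))\<^sup>2 \<le> L y" for y
    using strongly_convex_first_order[OF strongly_convex differentiable, of x y] x by simp
  have "x0 = x"
    unfolding minimizer_def
  proof (rule the_equality)
    show "\<forall>y. L x \<le> L y"
      using growth \<beta>_pos by (smt (verit) divide_pos_pos mult_nonneg_nonneg zero_le_power2)
    fix z assume "\<forall>y. L z \<le> L y"
    then have "\<beta> / 2 * (norm (z - x))\<^sup>2 \<le> 0"
      using growth[of z] by (smt (verit))
    then show "z = x"
      using \<beta>_pos by (simp add: mult_le_0_iff)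
  qed
  then show ?thesis
    using x by simp
qed

text \<open>The bound on \<open>s * K\<^sup>2\<close> lets half of the linear term absorb the
  quadratic one, which leaves the factor \<open>1 - s * \<beta>\<close> for the squared norm. An
  exponential bound and a square root then give the rate \<open>c\<close>.\<close>

lemma gradient_step_decay:
  assumes "0 \<le> s" and "s * K\<^sup>2 \<le> \<beta>" and "c \<le> \<beta> / 2"
  shows "norm (x - s *\<^sub>R g x - x0) \<le> exp (- c * s) * norm (x - x0)"
proof -
  have "1 - 2 * s * \<beta> + s\<^sup>2 * K\<^sup>2 = 1 - 2 * s * \<beta> + s * (s * K\<^sup>2)"
    by (simp add: power2_eq_square)
  also have "\<dots> \<le> 1 - 2 * s * \<beta> + s * \<beta>"
    using assms(1,2) mult_left_mono[of "s * K\<^sup>2" \<beta> s] by (simp add: mult.commute)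
  also have "\<dots> = 1 - s * \<beta>"
    by simp
  also have "\<dots> \<le> 1 - s * (2 * c)"
    using assms(1,3) mult_left_mono[of "2 * c" \<beta> s] by (simp add: mult.commute)
  also have "\<dots> \<le> exp (- (2 * c * s))"
    using exp_ge_add_one_self[of "- (2 * c * s)"] by (simp add: mult_ac)
  also have "\<dots> = (exp (- c * s))\<^sup>2"
    by (simp add: exp_double[symmetric])
  finally have q: "1 - 2 * s * \<beta> + s\<^sup>2 * K\<^sup>2 \<le> (exp (- c * s))\<^sup>2" .
  have "(norm (x - s *\<^sub>R g x - x0))\<^sup>2 \<le> (1 - 2 * s * \<beta> + s\<^sup>2 * K\<^sup>2) * (norm (x - x0))\<^sup>2"
    using gradient_step_contraction[OF assms(1), of x x0] by (simp add: gradient_minimizer)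
  also have "\<dots> \<le> (exp (- c * s))\<^sup>2 * (norm (x - x0))\<^sup>2"
    using q by (rule mult_right_mono) simp
  finally have "(norm (x - s *\<^sub>R g x - x0))\<^sup>2 \<le> (exp (- c * s))\<^sup>2 * (norm (x - x0))\<^sup>2" .
  then show ?thesis
    by (metis exp_ge_zero mult_nonneg_nonneg norm_ge_zero power2_le_imp_le power_mult_distrib)
qed

end

section \<open>Flows and jumps of hybrid solutions\<close>

text \<open>The flow conditions bind only where the time slice has nonempty interior, which
  \<open>a < b\<close> guarantees.\<close>

lemma hybrid_solution_flow:
  assumes sol: "hybrid_solution H E \<phi>" and "a < b" and sub: "{a..b} \<subseteq> time_slice E j"
  shows "absolutely_continuous_fun_on {a..b} (\<lambda>t. \<phi> t j)"
    and "AE t in lebesgue. t \<in> {a..b} \<longrightarrow>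
      ((\<lambda>s. \<phi> s j) has_vector_derivative flow_map H (\<phi> t j)) (at t within {a..b})"
    and "\<And>t. t \<in> {a<..<b} \<Longrightarrow> \<phi> t j \<in> flow_set H"
proof -
  show "absolutely_continuous_fun_on {a..b} (\<lambda>t. \<phi> t j)"
    using sol sub unfolding hybrid_solution_def locally_absolutely_continuous_on_def by blast
  have int: "{a<..<b} \<subseteq> interior (time_slice E j)"
    using interior_mono[OF sub] by simp
  then have ne: "interior (time_slice E j) \<noteq> {}"
    using \<open>a < b\<close> by (metis greaterThanLessThan_empty_iff leD subset_empty)
  have "AE t in lebesgue. t \<in> time_slice E j \<longrightarrow>
      ((\<lambda>s. \<phi> s j) has_vector_derivative flow_map H (\<phi> t j)) (at t within time_slice E j)"
    using sol ne unfolding hybrid_solution_def by blast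
  then show "AE t in lebesgue. t \<in> {a..b} \<longrightarrow>
      ((\<lambda>s. \<phi> s j) has_vector_derivative flow_map H (\<phi> t j)) (at t within {a..b})"
    by eventually_elim (use sub has_vector_derivative_within_subset in blast)
  show "\<phi> t j \<in> flow_set H" if "t \<in> {a<..<b}" for t
    using sol ne int that unfolding hybrid_solution_def by blast
qed

text \<open>The map \<open>h\<close> isolates a component of constant velocity, even while the whole
  velocity is not yet known to be constant.\<close>

lemma hybrid_solution_flow_affine:
  fixes \<phi> :: "real \<Rightarrow> nat \<Rightarrow> 'a::real_normed_vector" and h :: "'a \<Rightarrow> 'b::banach"
  assumes sol: "hybrid_solution H E \<phi>" and "a \<le> b" and sub: "{a..b} \<subseteq> time_slice E j"
    and h: "bounded_linear h" and c: "\<And>t. t \<in> {a..b} \<Longrightarrow> h (flow_map H (\<phi> t j)) = c"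
  shows "h (\<phi> b j) = h (\<phi> a j) + (b - a) *\<^sub>R c"
proof (cases "a = b")
  case False
  with \<open>a \<le> b\<close> have "a < b"
    by simp
  note flow = hybrid_solution_flow[OF sol this sub]
  have "AE t in lebesgue. t \<in> {a..b} \<longrightarrow> ((\<lambda>s. h (\<phi> s j)) has_vector_derivative c) (at t within {a..b})"
    using flow(2) by eventually_elim (use c bounded_linear.has_vector_derivative[OF h] in fastforce)
  with \<open>a \<le> b\<close> absolutely_continuous_fun_on_bounded_linear[OF flow(1) h] show ?thesis
    by (rule absolutely_continuous_affine)
qed simp

lemma gradient_hybrid_system_flow:
  fixes L :: "'a::euclidean_space \<Rightarrow> real"
  assumes sol: "hybrid_solution (gradient_hybrid_system L \<tau>min \<tau>max) E \<phi>"
    and "a \<le> b" and sub: "{a..b} \<subseteq> time_slice E j" and \<phi>a: "\<phi> a j = (z1, z2, \<tau>)"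
  shows "\<phi> b j = (z1 - (b - a) *\<^sub>R gradient L z2, z2, \<tau> - (b - a))"
proof -
  note affine = hybrid_solution_flow_affine[OF sol]
  have proj: "bounded_linear (\<lambda>x :: 'a \<times> 'a \<times> real. fst (snd x))"
    "bounded_linear (\<lambda>x :: 'a \<times> 'a \<times> real. snd (snd x))"
    by (intro bounded_linear_fst_comp bounded_linear_snd_comp bounded_linear_fst bounded_linear_snd)+
  have z2: "fst (snd (\<phi> t j)) = z2" if "t \<in> {a..b}" for t
  proof -
    have "{a..t} \<subseteq> time_slice E j"
      using sub that by auto
    then show ?thesis
      using affine[of a t j "\<lambda>x. fst (snd x)" 0] proj(1) that \<phi>a
      by (auto simp: gradient_hybrid_system_def split_def)
  qed
  have "fst (\<phi> b j) = z1 - (b - a) *\<^sub>R gradient L z2"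
    using affine[OF \<open>a \<le> b\<close> sub bounded_linear_fst, of "- gradient L z2"] z2 \<phi>a
    by (simp add: gradient_hybrid_system_def split_def)
  moreover have "snd (snd (\<phi> b j)) = \<tau> - (b - a)"
    using affine[OF \<open>a \<le> b\<close> sub proj(2), of "- 1"] \<phi>a
    by (simp add: gradient_hybrid_system_def split_def)
  ultimately show ?thesis
    using z2[of b] \<open>a \<le> b\<close> by (simp add: prod_eq_iff)
qed

text \<open>The timer runs down at unit speed and cannot be negative in the flow set.\<close>

lemma gradient_hybrid_system_dwell_time:
  fixes L :: "'a::euclidean_space \<Rightarrow> real"
  assumes sol: "hybrid_solution (gradient_hybrid_system L \<tau>min \<tau>max) E \<phi>"
    and "a \<le> b" and sub: "{a..b} \<subseteq> time_slice E j" and \<tau>: "snd (snd (\<phi> a j)) \<le> \<tau>max"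
    and "0 \<le> \<tau>max"
  shows "b - a \<le> \<tau>max"
proof (rule ccontr)
  assume "\<not> b - a \<le> \<tau>max"
  \<comment> \<open>The time lies strictly before \<open>b\<close> because the flow set condition
    covers interior times only; the timer would already be negative there.\<close>
  then obtain t where t: "a + \<tau>max < t" "t < b"
    using dense[of "a + \<tau>max" b] by auto
  obtain z1 z2 \<sigma> where \<phi>a: "\<phi> a j = (z1, z2, \<sigma>)"
    by (cases "\<phi> a j")
  have "{a..t} \<subseteq> time_slice E j"
    using sub t by auto
  then have "\<phi> t j = (z1 - (t - a) *\<^sub>R gradient L z2, z2, \<sigma> - (t - a))"
    using gradient_hybrid_system_flow[OF sol _ _ \<phi>a] t \<open>0 \<le> \<tau>max\<close> by simp
  moreover have "\<phi> t j \<in> flow_set (gradient_hybrid_system L \<tau>min \<tau>max)"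
    using hybrid_solution_flow(3)[OF sol _ sub, of t] t \<open>0 \<le> \<tau>max\<close> by simp
  ultimately show False
    using t \<tau> \<phi>a by (simp add: gradient_hybrid_system_def state_space_def)
qed

lemma gradient_hybrid_system_jump:
  assumes "hybrid_solution (gradient_hybrid_system L \<tau>min \<tau>max) E \<phi>"
    and "(t, j) \<in> E" and "(t, Suc j) \<in> E"
  obtains \<tau> where "\<phi> t (Suc j) = (fst (\<phi> t j), fst (\<phi> t j), \<tau>)" and "\<tau> \<in> {\<tau>min..\<tau>max}"
proof -
  have "\<phi> t (Suc j) \<in> jump_map (gradient_hybrid_system L \<tau>min \<tau>max) (\<phi> t j)"
    using assms unfolding hybrid_solution_def by blast
  then show ?thesis
    using that by (auto simp: gradient_hybrid_system_def split_def)
qed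

section \<open>Exponential decay\<close>

lemma norm_components_le_target_dist:
  "norm (fst \<xi> - minimizer L) \<le> target_dist L \<xi>"
  "norm (fst (snd \<xi>) - minimizer L) \<le> target_dist L \<xi>"
  by (auto simp: target_dist_def split_def intro!: real_le_rsqrt)

lemma target_dist_le:
  assumes "norm (z1 - minimizer L) \<le> r" and "norm (z2 - minimizer L) \<le> r"
  shows "target_dist L (z1, z2, \<tau>) \<le> sqrt 2 * r"
proof -
  have "0 \<le> r"
    using assms(1) norm_ge_zero order_trans by blast
  have "(norm (z1 - minimizer L))\<^sup>2 + (norm (z2 - minimizer L))\<^sup>2 \<le> r\<^sup>2 + r\<^sup>2"
    using assms by (intro add_mono power_mono) auto
  then have "target_dist L (z1, z2, \<tau>) \<le> sqrt (2 * r\<^sup>2)"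
    unfolding target_dist_def by simp
  then show ?thesis
    using \<open>0 \<le> r\<close> by (simp add: real_sqrt_mult)
qed

context smooth_strongly_convex
begin

text \<open>The constant collects 4/3 from the phase before the first jump, 12/11 from two dwell
  times whose decay is not counted, and \<open>sqrt 2\<close>, at most 3/2, from combining two
  components. The product 24/11 is below 8/3.\<close>

lemma hybrid_solution_decay:
  assumes sol: "hybrid_solution (gradient_hybrid_system L \<tau>min \<tau>max) E \<phi>"
    and "0 \<le> \<tau>max" and step: "\<tau>max * K\<^sup>2 \<le> \<beta> / 3" and c: "0 \<le> c" "c \<le> \<beta> / 8"
    and TJ: "(T, J) \<in> E" "1 \<le> J"
  shows "target_dist L (\<phi> T J) \<le> 8 / 3 * exp (- c * T) * target_dist L (\<phi> 0 0)"
proof -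
  define D where "D = target_dist L (\<phi> 0 0)"
  have "0 \<le> D"
    by (simp add: D_def target_dist_def split_def)
  have "\<tau>max * K * K \<le> 1 / 3 * K"
    using step strong_convexity_le_smoothness by (simp add: power2_eq_square mult.assoc)
  then have \<tau>K: "\<tau>max * K \<le> 1 / 3"
    using smoothness_pos by simp
  \<comment> \<open>This exponent measures the loss over two dwell times; it is at most a quarter of
    \<open>\<tau>max * K\<close>.\<close>
  have "2 * c * \<tau>max \<le> 2 * (\<beta> / 8) * \<tau>max"
    using c(2) \<open>0 \<le> \<tau>max\<close> by (intro mult_right_mono) auto
  also have "\<dots> \<le> 2 * (K / 8) * \<tau>max"
    using strong_convexity_le_smoothness \<open>0 \<le> \<tau>max\<close> by (intro mult_right_mono) auto
  finally have c\<tau>: "2 * c * \<tau>max \<le> 1 / 12"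
    using \<tau>K by (simp add: mult.commute)
  have decay: "norm (x - s *\<^sub>R g x - x0) \<le> exp (- c * s) * norm (x - x0)" if "0 \<le> s" "s \<le> \<tau>max" for x s
  proof (rule gradient_step_decay)
    have "s * K\<^sup>2 \<le> \<tau>max * K\<^sup>2"
      using that by (intro mult_right_mono) auto
    then show "s * K\<^sup>2 \<le> \<beta>"
      using step \<beta>_pos by linarith
  qed (use that c \<beta>_pos in auto)
  have "\<exists>t::nat \<Rightarrow> real. t 0 = 0 \<and> (\<forall>i\<le>J. t i \<le> t (Suc i)) \<and> t (Suc J) = T \<and>
      E \<inter> ({0..T} \<times> {0..J}) = (\<Union>i\<in>{0..J}. {t i..t (Suc i)} \<times> {i})"
    using sol TJ(1) unfolding hybrid_solution_def hybrid_time_domain_def by blast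
  \<comment> \<open>For \<open>i < J\<close>, \<open>t (Suc i)\<close> is the time of the jump from
    \<open>i\<close> to \<open>Suc i\<close>, whereas \<open>t (Suc J)\<close> is only the
    observation time \<open>T\<close>.\<close>
  then obtain t :: "nat \<Rightarrow> real" where t0: "t 0 = 0" and mono: "\<And>i. i \<le> J \<Longrightarrow> t i \<le> t (Suc i)"
    and tJ: "t (Suc J) = T"
    and dom: "E \<inter> ({0..T} \<times> {0..J}) = (\<Union>i\<in>{0..J}. {t i..t (Suc i)} \<times> {i})"
    by blast
  have slice: "{t i..t (Suc i)} \<subseteq> time_slice E i" if "i \<le> J" for i
    using dom that by (fastforce simp: time_slice_def)
  have jump: "\<exists>\<tau>. \<phi> (t (Suc i)) (Suc i) = (fst (\<phi> (t (Suc i)) i), fst (\<phi> (t (Suc i)) i), \<tau>) \<and> \<tau> \<le> \<tau>max"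
    if "Suc i \<le> J" for i
  proof -
    have "(t (Suc i), i) \<in> E" "(t (Suc i), Suc i) \<in> E"
      using slice[of i] slice[of "Suc i"] mono[of i] mono[of "Suc i"] that
      by (auto simp: time_slice_def)
    from gradient_hybrid_system_jump[OF sol this] show ?thesis
      by (metis atLeastAtMost_iff)
  qed
  have timer: "snd (snd (\<phi> (t i) i)) \<le> \<tau>max" if "i \<le> J" for i
  proof (cases i)
    case 0
    have "\<phi> 0 0 \<in> flow_set (gradient_hybrid_system L \<tau>min \<tau>max)
        \<union> jump_set (gradient_hybrid_system L \<tau>min \<tau>max)"
      using sol unfolding hybrid_solution_def by blast
    then show ?thesis
      using \<open>0 \<le> \<tau>max\<close> 0 t0 by (auto simp: gradient_hybrid_system_def state_space_def)
  next
    case (Suc k)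
    then show ?thesis
      using jump[of k] that by auto
  qed
  have dwell: "t (Suc i) - t i \<le> \<tau>max" if "i \<le> J" for i
    using gradient_hybrid_system_dwell_time[OF sol mono slice timer] that \<open>0 \<le> \<tau>max\<close> by blast
  note flow = gradient_hybrid_system_flow[OF sol mono slice]
  define e where "e = norm (fst (\<phi> (t 1) 1) - x0)"
  \<comment> \<open>Before the first jump \<open>z2\<close> need not match \<open>z1\<close>, so no
    contraction is available; by the Lipschitz bound the drift adds at most a third of
    \<open>D\<close>.\<close>
  have e: "e \<le> 4 / 3 * D"
  proof -
    obtain z1 z2 \<tau> where \<phi>0: "\<phi> 0 0 = (z1, z2, \<tau>)"
      by (cases "\<phi> 0 0")
    have D: "norm (z1 - x0) \<le> D" "norm (z2 - x0) \<le> D"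
      using norm_components_le_target_dist[of "\<phi> 0 0" L] by (simp_all add: \<phi>0 D_def)
    have "\<phi> (t 1) 0 = (z1 - t 1 *\<^sub>R g z2, z2, \<tau> - t 1)"
      using flow[of 0 z1 z2 \<tau>] \<phi>0 t0 by simp
    then have "e = norm ((z1 - x0) - t 1 *\<^sub>R g z2)"
      using jump[of 0] TJ(2) by (auto simp: e_def algebra_simps)
    also have "\<dots> \<le> norm (z1 - x0) + norm (t 1 *\<^sub>R g z2)"
      by (rule norm_triangle_ineq4)
    also have "norm (t 1 *\<^sub>R g z2) \<le> \<tau>max * (K * norm (z2 - x0))"
      using dwell[of 0] mono[of 0] t0 gradient_lipschitz[of z2 x0] \<open>0 \<le> \<tau>max\<close>
      by (auto simp: gradient_minimizer intro!: mult_mono)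
    also have "\<dots> = \<tau>max * K * norm (z2 - x0)"
      by simp
    also have "\<dots> \<le> 1 / 3 * D"
      using \<tau>K D(2) by (intro mult_mono) auto
    finally show ?thesis
      using D(1) by simp
  qed
  \<comment> \<open>Right after a jump both components agree, so the next dwell is one gradient
    step, whose result is copied again. The decay factors multiply, and the dwell times telescope
    from \<open>t 1\<close>.\<close>
  have jumps: "\<exists>x \<tau>. \<phi> (t (Suc i)) (Suc i) = (x, x, \<tau>) \<and> norm (x - x0) \<le> exp (- c * (t (Suc i) - t 1)) * e"
    if "Suc i \<le> J" for i
    using that
  proof (induction i)
    case 0
    then show ?case
      using jump[of 0] by (auto simp: e_def)
  next
    case (Suc i)
    define s where "s = t (Suc (Suc i)) - t (Suc i)"
    obtain x \<tau> where x: "\<phi> (t (Suc i)) (Suc i) = (x, x, \<tau>)"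
      "norm (x - x0) \<le> exp (- c * (t (Suc i) - t 1)) * e"
      using Suc by auto
    have "fst (\<phi> (t (Suc (Suc i))) (Suc i)) = x - s *\<^sub>R g x"
      using flow[of "Suc i"] x(1) Suc.prems by (simp add: s_def)
    then obtain \<sigma> where "\<phi> (t (Suc (Suc i))) (Suc (Suc i)) = (x - s *\<^sub>R g x, x - s *\<^sub>R g x, \<sigma>)"
      using jump[of "Suc i"] Suc.prems by auto
    moreover have "norm (x - s *\<^sub>R g x - x0) \<le> exp (- c * (t (Suc (Suc i)) - t 1)) * e"
    proof -
      have "norm (x - s *\<^sub>R g x - x0) \<le> exp (- c * s) * norm (x - x0)"
        using decay[of s x] mono[of "Suc i"] dwell[of "Suc i"] Suc.prems by (simp add: s_def)
      also have "\<dots> \<le> exp (- c * s) * (exp (- c * (t (Suc i) - t 1)) * e)"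
        using x(2) by (intro mult_left_mono) auto
      also have "\<dots> = exp (- c * (t (Suc (Suc i)) - t 1)) * e"
        by (simp add: s_def exp_add[symmetric] algebra_simps)
      finally show ?thesis .
    qed
    ultimately show ?case
      by blast
  qed
  obtain k where k: "J = Suc k"
    using TJ(2) by (cases J) auto
  obtain x \<tau> where x: "\<phi> (t J) J = (x, x, \<tau>)" "norm (x - x0) \<le> exp (- c * (t J - t 1)) * e"
    using jumps[of k] by (auto simp: k)
  \<comment> \<open>At time \<open>T\<close> the first component has made a partial step of size
    \<open>s\<close>, while the second is still at \<open>x\<close>.\<close>
  define s where "s = T - t J"
  have s: "0 \<le> s" "s \<le> \<tau>max"
    using mono[of J] dwell[of J] by (auto simp: s_def tJ)
  have \<phi>T: "\<phi> T J = (x - s *\<^sub>R g x, x, \<tau> - s)"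
    using flow[OF _ _ x(1)] by (simp add: s_def tJ)
  \<comment> \<open>At most \<open>\<tau>max\<close> passes before the first jump and again after
    the last one, so replacing \<open>t J - t 1\<close> by \<open>T\<close> costs the factor
    \<open>exp (2 * c * \<tau>max)\<close>.\<close>
  have "exp (- c * (t J - t 1)) * e \<le> exp (2 * c * \<tau>max) * exp (- c * T) * (4 / 3 * D)"
  proof -
    have "T - 2 * \<tau>max \<le> t J - t 1"
      using s dwell[of 0] t0 by (simp add: s_def)
    then have "c * (T - 2 * \<tau>max) \<le> c * (t J - t 1)"
      using c(1) by (rule mult_left_mono)
    then have "exp (- c * (t J - t 1)) \<le> exp (2 * c * \<tau>max) * exp (- c * T)"
      by (simp add: exp_add[symmetric] algebra_simps)
    then show ?thesis
      using e by (intro mult_mono) (auto simp: e_def)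
  qed
  also have "\<dots> \<le> 12 / 11 * exp (- c * T) * (4 / 3 * D)"
  proof -
    have "exp (2 * c * \<tau>max) \<le> exp (1 / 12)"
      using c\<tau> by simp
    \<comment> \<open>\<open>exp (- (1 / 12))\<close> is at least 11/12; the claim is its
      inverse.\<close>
    also have "\<dots> \<le> (12 / 11 :: real)"
      using exp_ge_add_one_self[of "- (1 / 12) :: real"] by (simp add: exp_minus field_simps)
    finally show ?thesis
      using \<open>0 \<le> D\<close> by (intro mult_right_mono) auto
  qed
  finally have r: "norm (x - x0) \<le> 16 / 11 * exp (- c * T) * D"
    using x(2) by (simp add: mult_ac)
  \<comment> \<open>The decay of the partial step is discarded, since the lagging second component
    does not share it.\<close>
  have "norm (x - s *\<^sub>R g x - x0) \<le> exp (- c * s) * norm (x - x0)"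
    by (rule decay[OF s])
  also have "\<dots> \<le> norm (x - x0)"
    using c(1) s(1) by (intro mult_left_le_one_le) auto
  finally have "target_dist L (\<phi> T J) \<le> sqrt 2 * (16 / 11 * exp (- c * T) * D)"
    unfolding \<phi>T by (intro target_dist_le) (use r in auto)
  also have "\<dots> \<le> 3 / 2 * (16 / 11 * exp (- c * T) * D)"
    using \<open>0 \<le> D\<close> by (intro mult_right_mono real_le_lsqrt) (auto simp: power2_eq_square)
  also have "\<dots> \<le> 8 / 3 * exp (- c * T) * D"
    using \<open>0 \<le> D\<close> by (simp add: mult_right_mono)
  finally show ?thesis
    by (simp add: D_def)
qed

end

theorem theorem1:
  fixes L :: "real ^ 'n \<Rightarrow> real"
    and \<beta> K \<tau>min \<tau>max A B :: real
  assumes "twice_continuously_differentiable L"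
    and "\<beta> > 0" and "strongly_convex \<beta> L"
    and "smooth K L"
    and "0 < \<tau>min" and "\<tau>min \<le> \<tau>max" and "\<tau>max < \<beta>\<^sup>2 / (3 * K ^ 3)"
    and A_def: "A = \<beta>\<^sup>2 * (1 - 2 * \<tau>max * K) - \<tau>max * K ^ 3"
    and B_def: "B = 1 - 2 * \<tau>max * K"
  shows "A > 0 \<and> B \<in> {0<..<1} \<and>
    (\<forall>E \<phi>. hybrid_solution (gradient_hybrid_system L \<tau>min \<tau>max) E \<phi> \<longrightarrow>
      (\<forall>(t, j)\<in>E. j \<ge> 1 \<longrightarrow>
        target_dist L (\<phi> t j)
          \<le> 8 / 3 * root 4 2 * sqrt (K / \<beta>) * exp (- (\<beta> * A * B / (8 * K\<^sup>2)) * t)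
             * target_dist L (\<phi> 0 0)))"
proof -
  interpret smooth_strongly_convex L \<beta> K
    by unfold_locales (use assms in auto)
  note \<beta>K = strong_convexity_le_smoothness
  have "\<tau>max > 0"
    using assms(5,6) by simp
  have \<tau>K3: "\<tau>max * K ^ 3 < \<beta>\<^sup>2 / 3"
    using assms(7) smoothness_pos by (simp add: field_simps)
  \<comment> \<open>One factor \<open>K\<close> is cancelled against one factor
    \<open>\<beta>\<close>, using that \<open>\<beta>\<close> is at most \<open>K\<close>; the next
    bound repeats this.\<close>
  have "\<tau>max * K\<^sup>2 * K < \<beta> / 3 * \<beta>"
    using \<tau>K3 by (simp add: power2_eq_square power3_eq_cube)
  also have "\<dots> \<le> \<beta> / 3 * K"
    using \<beta>K \<open>\<beta> > 0\<close> by (intro mult_left_mono) auto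
  finally have step: "\<tau>max * K\<^sup>2 < \<beta> / 3"
    using smoothness_pos by simp
  then have "\<tau>max * K * K < 1 / 3 * K"
    using \<beta>K by (simp add: power2_eq_square)
  then have \<tau>K: "\<tau>max * K < 1 / 3"
    using smoothness_pos by (simp del: times_divide_eq_left)
  then have B: "0 < B" "B < 1" "1 / 3 < B"
    using \<open>\<tau>max > 0\<close> smoothness_pos by (auto simp: B_def mult_ac)
  \<comment> \<open>A third of \<open>\<beta>\<^sup>2\<close> separates the two terms of
    \<open>A\<close>.\<close>
  have "\<beta>\<^sup>2 * (1 / 3) < \<beta>\<^sup>2 * B"
    using B(3) \<open>\<beta> > 0\<close> by simp
  then have "A > 0"
    using \<tau>K3 by (simp add: A_def B_def)
  have "\<beta>\<^sup>2 * B \<le> \<beta>\<^sup>2"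
    using B by (simp add: mult_left_le)
  moreover have "0 < \<tau>max * K ^ 3"
    using \<open>\<tau>max > 0\<close> smoothness_pos by simp
  ultimately have "A \<le> \<beta>\<^sup>2"
    by (simp add: A_def B_def)
  also have "\<dots> \<le> K\<^sup>2"
    using \<beta>K \<open>\<beta> > 0\<close> by (intro power_mono) auto
  finally have "A * B \<le> K\<^sup>2"
    using B \<open>A > 0\<close> mult_left_le[of B A] by linarith
  \<comment> \<open>This is the stated rate; the bound on \<open>A * B\<close> brings it below
    \<open>\<beta> / 8\<close>, as the decay estimate requires.\<close>
  define c where "c = \<beta> * A * B / (8 * K\<^sup>2)"
  have "0 \<le> c"
    using \<open>A > 0\<close> B(1) \<open>\<beta> > 0\<close> by (simp add: c_def)
  have "\<beta> * (A * B) \<le> \<beta> * K\<^sup>2"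
    using \<open>A * B \<le> K\<^sup>2\<close> \<open>\<beta> > 0\<close> by (intro mult_left_mono) auto
  then have "c \<le> \<beta> / 8"
    using smoothness_pos by (simp add: c_def field_simps)
  have "target_dist L (\<phi> t j)
      \<le> 8 / 3 * root 4 2 * sqrt (K / \<beta>) * exp (- c * t) * target_dist L (\<phi> 0 0)"
    if "hybrid_solution (gradient_hybrid_system L \<tau>min \<tau>max) E \<phi>" "(t, j) \<in> E" "1 \<le> j" for E \<phi> t j
  proof -
    \<comment> \<open>Both extra factors are at least 1, so the bound with the constant 8/3 alone
      implies the stated one.\<close>
    have "1 * 1 \<le> root 4 2 * sqrt (K / \<beta>)"
      using \<beta>K \<open>\<beta> > 0\<close> by (intro mult_mono) auto
    then have "8 / 3 * (exp (- c * t) * target_dist L (\<phi> 0 0))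
        \<le> 8 / 3 * (root 4 2 * sqrt (K / \<beta>)) * (exp (- c * t) * target_dist L (\<phi> 0 0))"
      by (intro mult_right_mono) (auto simp: target_dist_def split_def)
    moreover have "target_dist L (\<phi> t j) \<le> 8 / 3 * exp (- c * t) * target_dist L (\<phi> 0 0)"
      using that \<open>\<tau>max > 0\<close> step \<open>0 \<le> c\<close> \<open>c \<le> \<beta> / 8\<close> by (intro hybrid_solution_decay[OF that(1)]) auto
    ultimately show ?thesis
      by (simp add: mult_ac)
  qed
  then show ?thesis
    using \<open>A > 0\<close> B unfolding c_def by auto
qed

end
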